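(* Let $D\subset\mathbb{R}^2$ be open, let $f:D\to\mathbb{R}$ be continuous, and let $(t_0,x_0^{(0)})\in D$. Consider the initial value problem $\frac{dx}{dt}=f(t,x)$, $x(t_0)=x_0^{(0)}$, and the associated nonlinear operator $N[x]=\frac{dx}{dt}-f(t,x)$. Let $c_0=-1$ and let $(u_m)_{m\ge 0}$ be the functions defined recursively (IFOHAM algorithm) by $u_0(t)=x_0^{(0)}$ (constant) and, for $m\ge 0$, $$\mathcal{L}[u_{m+1}(t)]=c_0\,N\Big[\sum_{k=0}^{m}u_k(t)\Big],\qquad u_{m+1}(t_0)=0,$$ where $\mathcal{L}[h]=\frac{dh}{dt}$. Let $(x_m)_{m\ge 0}$ be the Picard–Lindelöf iterates defined by $x_0(t)=x_0^{(0)}$ and, for $m\ge 0$, $$x_{m+1}(t)=x_0^{(0)}+\int_{t_0}^{t}f(\xi,x_m(\xi))\,d\xi .$$ Then for every $m\in\mathbb{N}_0$ and every interval $J$ containing $t_0$ such that $(t,x_k(t))\in D$ for all $t\in J$ and all integers $0\le k\le m-1$ (both recursions being then defined on $J$ up to index $m$), $$x_m(t)=\sum_{k=0}^{m}u_k(t)\qquad\text{for all } t\in J.$$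
   Context: The initial guess $x_0(t)=u_0(t)=x_0^{(0)}$ is a constant function; $x_0^{(0)}\in\mathbb{R}$ is the prescribed initial value, and the superscript $(0)$ is only part of its name. The inverse of $\mathcal{L}=\frac{d}{dt}$ used is $\mathcal{L}^{-1}[h](t)=\int_{t_0}^{t}h(\xi)\,d\xi$, so the recursion for $u$ reads $u_{m+1}(t)=c_0\int_{t_0}^{t}\big[\sum_{k=0}^m u_k'(\xi)-f\big(\xi,\sum_{k=0}^m u_k(\xi)\big)\big]d\xi$. $\mathbb{N}_0=\{0,1,2,\dots\}$. *)

theory Defs
  imports "HOL-Analysis.Analysis"
begin

definition ode_op :: "(real \<times> real \<Rightarrow> real) \<Rightarrow> (real \<Rightarrow> real) \<Rightarrow> real \<Rightarrow> real" where
  "ode_op f x t = deriv x t - f (t, x t)"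

(* The oriented integral: for t < t0 it is minus the integral over the interval from t to t0. *)
definition deriv_inv :: "real \<Rightarrow> (real \<Rightarrow> real) \<Rightarrow> real \<Rightarrow> real" where
  "deriv_inv t0 h t = (LBINT \<xi>=t0..t. h \<xi>)"

lemma deriv_inv_solves:
  assumes "continuous_on {a..b} h" "t0 \<in> {a..b}" "t \<in> {a..b}"
  shows "(deriv_inv t0 h has_real_derivative h t) (at t within {a..b})"
    and "deriv_inv t0 h t0 = 0"
proof -
  show "(deriv_inv t0 h has_real_derivative h t) (at t within {a..b})"
    using interval_integral_FTC2[of a t0 b h t] assms
    by (simp add: deriv_inv_def[abs_def] has_real_derivative_iff_has_vector_derivative)
  show "deriv_inv t0 h t0 = 0"
    by (simp add: deriv_inv_def)
qed

(* Both sequences below consist of total functions on the real line. Their values at t depend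
   only on data over the segment between t0 and t, so they are the intended functions on every
   interval J around t0 over which the graphs of the preceding iterates stay in the domain of f.
   The derivative inside ode_op is two-sided; a boundary point of J where only a one-sided
   derivative makes sense is an endpoint of the integration range and does not affect the
   integral. *)

primrec picard :: "(real \<times> real \<Rightarrow> real) \<Rightarrow> real \<Rightarrow> real \<Rightarrow> nat \<Rightarrow> real \<Rightarrow> real" where
  "picard f t0 x0 0 = (\<lambda>t. x0)"
| "picard f t0 x0 (Suc m) = (\<lambda>t. x0 + (LBINT \<xi>=t0..t. f (\<xi>, picard f t0 x0 m \<xi>)))"

(* The solution of deriv u = c0 * ode_op f (sum of the previous terms) with u t0 = 0. *)
fun ifoham :: "real \<Rightarrow> (real \<times> real \<Rightarrow> real) \<Rightarrow> real \<Rightarrow> real \<Rightarrow> nat \<Rightarrow> real \<Rightarrow> real" where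
  "ifoham c0 f t0 x0 0 = (\<lambda>t. x0)"
| "ifoham c0 f t0 x0 (Suc m) =
     deriv_inv t0 (\<lambda>\<xi>. c0 * ode_op f (\<lambda>t. \<Sum>k\<le>m. ifoham c0 f t0 x0 k t) \<xi>)"

end

theory Submission
  imports Defs
begin

text \<open>On an interval on which the partial sum \<open>\<Sum>k\<le>m. u k\<close> equals the Picard iterate \<open>x m\<close>, the
  derivative part of \<open>u (m + 1)\<close> integrates to \<open>- (x m t - x0)\<close>, while the remaining part
  integrates to \<open>x (m + 1) t - x0\<close>; so adding \<open>u (m + 1)\<close> to \<open>x m\<close> gives \<open>x (m + 1)\<close>.\<close>

lemma picard_Suc_deriv_inv:
  "picard f t0 x0 (Suc m) = (\<lambda>t. x0 + deriv_inv t0 (\<lambda>\<xi>. f (\<xi>, picard f t0 x0 m \<xi>)) t)"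
  by (simp add: deriv_inv_def)

lemma continuous_on_graph_compose:
  assumes "continuous_on D f" "continuous_on S x" "\<And>t. t \<in> S \<Longrightarrow> (t, x t) \<in> D"
  shows "continuous_on S (\<lambda>t. f (t, x t))"
  by (rule continuous_on_compose2[OF assms(1)])
     (use assms in \<open>auto intro: continuous_on_Pair continuous_on_id\<close>)

lemma picard_Suc_has_derivative:
  assumes "continuous_on {a..b} (\<lambda>t. f (t, picard f t0 x0 m t))" "t0 \<in> {a..b}" "t \<in> {a..b}"
  shows "(picard f t0 x0 (Suc m) has_real_derivative f (t, picard f t0 x0 m t))
    (at t within {a..b})"
  unfolding picard_Suc_deriv_inv
  using DERIV_add[OF DERIV_const[of x0] deriv_inv_solves(1)[OF assms]] by simp

text \<open>After the constant start, each iterate is an indefinite integral of \<open>f\<close>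
  along the graph of its predecessor, hence differentiable. So only the graphs of the iterates
  before \<open>m\<close> have to stay in \<open>D\<close>.\<close>

lemma continuous_on_picard:
  assumes "continuous_on D f" "t0 \<in> {a..b}"
    and "\<And>k t. k < m \<Longrightarrow> t \<in> {a..b} \<Longrightarrow> (t, picard f t0 x0 k t) \<in> D"
  shows "continuous_on {a..b} (picard f t0 x0 m)"
  using assms(3)
proof (induction m)
  case (Suc m)
  have "continuous_on {a..b} (\<lambda>t. f (t, picard f t0 x0 m t))"
    using Suc by (intro continuous_on_graph_compose[OF assms(1)]) auto
  from DERIV_continuous_on[OF picard_Suc_has_derivative[OF this assms(2)]] show ?case .
qed simp

text \<open>A continuous \<open>g\<close> as derivative is what the fundamental theorem of calculus
  needs to integrate it back. Naming it \<open>g\<close> treats the constant iterate, with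
  \<open>g = 0\<close>, and the later ones alike.\<close>

lemma picard_C1:
  assumes "continuous_on D f" "t0 \<in> {a..b}"
    and "\<And>k t. k < m \<Longrightarrow> t \<in> {a..b} \<Longrightarrow> (t, picard f t0 x0 k t) \<in> D"
  obtains g where "continuous_on {a..b} g"
    "\<And>t. t \<in> {a..b} \<Longrightarrow> (picard f t0 x0 m has_real_derivative g t) (at t within {a..b})"
proof (cases m)
  case 0
  then show thesis
    using that[of "\<lambda>_. 0"] by simp
next
  case (Suc n)
  have "continuous_on {a..b} (\<lambda>t. f (t, picard f t0 x0 n t))"
    using assms Suc
    by (intro continuous_on_graph_compose[OF assms(1)] continuous_on_picard[OF assms(1)]) auto
  then show thesis
    using that picard_Suc_has_derivative assms(2) Suc by blast
qed

lemma picard_at_t0 [simp]: "picard f t0 x0 m t0 = x0"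
  by (cases m) simp_all

lemma sum_ifoham_eq_picard:
  assumes f: "continuous_on D f" and t0: "t0 \<in> {a..b}"
    and "\<And>k t. k < m \<Longrightarrow> t \<in> {a..b} \<Longrightarrow> (t, picard f t0 x0 k t) \<in> D"
    and "t \<in> {a..b}"
  shows "(\<Sum>k\<le>m. ifoham (-1) f t0 x0 k t) = picard f t0 x0 m t"
  using assms(3,4)
\<comment> \<open>The point \<open>t\<close> is generalised because the next term at
  \<open>t\<close> integrates over the partial sum and its derivative at other points.\<close>
proof (induction m arbitrary: t)
  case (Suc m)
  let ?S = "\<lambda>t. \<Sum>k\<le>m. ifoham (-1) f t0 x0 k t"
  let ?x = "picard f t0 x0 m"
  let ?F = "\<lambda>\<xi>. f (\<xi>, ?x \<xi>)"
  have S: "?S s = ?x s" if "s \<in> {a..b}" for s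
    using Suc.IH Suc.prems(1) that less_SucI by blast
  obtain g where g: "continuous_on {a..b} g"
    "\<And>s. s \<in> {a..b} \<Longrightarrow> (?x has_real_derivative g s) (at s within {a..b})"
    using picard_C1[OF f t0, of m x0] Suc.prems(1) less_SucI by metis
  have F: "continuous_on {a..b} ?F"
    using Suc.prems
    by (intro continuous_on_graph_compose[OF f] continuous_on_picard[OF f t0]) auto
  have sub: "{min t0 t..max t0 t} \<subseteq> {a..b}"
    using t0 Suc.prems(2) by auto
  \<comment> \<open>\<open>?S\<close> and \<open>?x\<close> are known to agree only on
    \<open>{a..b}\<close>, so the two-sided derivative carries over just at interior points, which
    have a neighbourhood inside.\<close>
  have deriv_S: "deriv ?S \<xi> = g \<xi>" if "\<xi> \<in> {a<..<b}" for \<xi>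
  proof -
    have "(?x has_real_derivative g \<xi>) (at \<xi>)"
      using g(2)[of \<xi>] that at_within_Icc_at[of a \<xi> b] by simp
    then have "(?S has_real_derivative g \<xi>) (at \<xi>)"
      by (rule has_field_derivative_transform_within_open[where S = "{a<..<b}"])
         (use that S in auto)
    then show ?thesis
      by (rule DERIV_imp_deriv)
  qed
  \<comment> \<open>Needed to split the integral of \<open>?F - g\<close> below. The point
    \<open>t\<close> may lie to the left of \<open>t0\<close>, hence the two cases.\<close>
  have integrable: "interval_lebesgue_integrable lborel (ereal t0) (ereal t) h"
    if "continuous_on {a..b} h" for h :: "real \<Rightarrow> real"
  proof (cases "t0 \<le> t")
    case True
    then show ?thesis
      using interval_integrable_continuous_on continuous_on_subset[OF that sub] by simp
  next
    case False
    then have "interval_lebesgue_integrable lborel (ereal t) (ereal t0) h"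
      using interval_integrable_continuous_on[of t t0 h] continuous_on_subset[OF that sub] by simp
    then show ?thesis
      using interval_integrable_endpoints_reverse by blast
  qed
  have "(LBINT \<xi>=t0..t. g \<xi>) = ?x t - ?x t0"
  proof (rule interval_integral_FTC_finite)
    show "continuous_on {min t0 t..max t0 t} g"
      using continuous_on_subset[OF g(1) sub] .
    show "(?x has_vector_derivative g s) (at s within {min t0 t..max t0 t})"
      if "min t0 t \<le> s" "s \<le> max t0 t" for s
    proof -
      have "s \<in> {a..b}"
        using that sub by (meson atLeastAtMost_iff subsetD)
      from DERIV_subset[OF g(2)[OF this] sub] show ?thesis
        by (simp only: has_real_derivative_iff_has_vector_derivative)
    qed
  qed
  then have int_g: "(LBINT \<xi>=t0..t. g \<xi>) = ?x t - x0"
    by simp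
  have "ifoham (-1) f t0 x0 (Suc m) t = (LBINT \<xi>=t0..t. ?F \<xi> - g \<xi>)"
    unfolding ifoham.simps deriv_inv_def
  \<comment> \<open>The integrands are compared only on the open segment between \<open>t0\<close>
    and \<open>t\<close>, which lies in \<open>{a<..<b}\<close>; there \<open>deriv_S\<close>
    applies, and the factor -1 turns \<open>g - ?F\<close> into \<open>?F - g\<close>.\<close>
  proof (rule interval_integral_cong)
    fix \<xi> assume "\<xi> \<in> einterval (min (ereal t0) (ereal t)) (max (ereal t0) (ereal t))"
    then have "\<xi> \<in> {a<..<b}"
      using t0 Suc.prems(2) by (auto simp: einterval_def min_def max_def split: if_splits)
    then show "-1 * ode_op f ?S \<xi> = ?F \<xi> - g \<xi>"
      using deriv_S S[of \<xi>] by (simp add: ode_op_def)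
  qed
  also have "\<dots> = (LBINT \<xi>=t0..t. ?F \<xi>) - (?x t - x0)"
    using F g(1) integrable int_g by simp
  finally show ?case
    using S[OF Suc.prems(2)] by simp
qed simp

theorem proposition1:
  fixes D :: "(real \<times> real) set" and f :: "real \<times> real \<Rightarrow> real"
    and t0 x0 c0 :: real and m :: nat and J :: "real set"
  assumes "open D" and "continuous_on D f" and "(t0, x0) \<in> D"
    and "c0 = -1"
    and "is_interval J" and "t0 \<in> J"
    and "\<And>k t. k < m \<Longrightarrow> t \<in> J \<Longrightarrow> (t, picard f t0 x0 k t) \<in> D"
  shows "\<forall>t\<in>J. picard f t0 x0 m t = (\<Sum>k\<le>m. ifoham c0 f t0 x0 k t)"
proof
  fix t assume t: "t \<in> J"
  \<comment> \<open>\<open>J\<close> may be unbounded or not closed. The compact segment between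
    \<open>t0\<close> and \<open>t\<close> lies in \<open>J\<close> and suffices for the value at
    \<open>t\<close>.\<close>
  let ?I = "{min t0 t..max t0 t}"
  have "min t0 t \<in> J" "max t0 t \<in> J"
    using t assms(6) by (simp_all add: min_def max_def)
  then have "?I \<subseteq> J"
    using mem_is_interval_1_I[OF assms(5)] by (meson atLeastAtMost_iff subsetI)
  then have "(s, picard f t0 x0 k s) \<in> D" if "k < m" "s \<in> ?I" for k s
    using assms(7) that by blast
  then have "(\<Sum>k\<le>m. ifoham (-1) f t0 x0 k t) = picard f t0 x0 m t"
    by (intro sum_ifoham_eq_picard[OF assms(2), where a = "min t0 t" and b = "max t0 t"])
      simp_all
  then show "picard f t0 x0 m t = (\<Sum>k\<le>m. ifoham c0 f t0 x0 k t)"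
    unfolding assms(4) by (rule sym)
qed

end
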